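(* Let $h:\mathbb{R}^n\to\mathbb{R}^m$ have a functional decomposition with $K$ compositions, given by unary or binary functions $h_j$, $j=n+1,\dots,n+K$ (as defined in the context), let $D_{\mathcal H}\subset\mathbb{R}^n$, and define $$\mathcal H=\left\{(w_1,\dots,w_{n+K})\ \middle|\ (w_1,\dots,w_n)\in D_{\mathcal H},\ w_j=h_j(w_{j1}\{,w_{j2}\})\ \ \forall j\in\{n+1,\dots,n+K\}\right\}\subset\mathbb{R}^{n+K}.$$ Let $D_j\subseteq\mathbb{R}$ be sets with $D_j\supseteq e_j\mathcal H$ for all $j\in\{1,\dots,n+K\}$ (i.e. $D_j$ contains the projection of $\mathcal H$ onto its $j$-th coordinate). For $\ell\in\{n+1,\dots,n+K\}$ let $$\mathcal H_\ell=\left\{(w_{\ell1}\{,w_{\ell2}\},w_\ell)\ \middle|\ (w_{\ell1}\{,w_{\ell2}\})\in D_{\ell1}\{\times D_{\ell2}\},\ w_\ell=h_\ell(w_{\ell1}\{,w_{\ell2}\})\right\}.$$ Define $\mathcal H_{1:n}=D_{\mathcal H}$ and, for $\ell=n+1,\dots,n+K$, $$\mathcal H_{1:\ell}=(\mathcal H_{1:\ell-1}\times D_\ell)\cap_{E_\ell}\mathcal H_\ell,\qquad E_\ell=\begin{bmatrix}e_{\ell1}\\ \{e_{\ell2}\}\\ e_\ell\end{bmatrix},$$ where the $e_i$ in $E_\ell$ are rows of the $\ell\times\ell$ identity matrix. Then $\mathcal H_{1:n+K}=\mathcal H$.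
   Context: Functional decomposition: a function $h:\mathbb{R}^n\to\mathbb{R}^m$ is decomposed by introducing intermediate variables $w_j=x_j$ for $j=1,\dots,n$ and $w_j=h_j(w_{j1}\{,w_{j2}\})$ for $j=n+1,\dots,n+K$, where each $h_j$ is a real-valued function that is either unary (one scalar argument) or binary (two scalar arguments), and its argument indices $j1,j2\in\{1,\dots,j-1\}$ are fixed indices attached to $j$; the last $m$ variables give the output: $h(x)=(w_{n+K-m+1},\dots,w_{n+K})$ for all $x$. Braces convention: entries in braces $\{\cdot\}$ (such as $\{,w_{j2}\}$, $\{e_{\ell2}\}$, $\{\times D_{\ell2}\}$) are present when the function in question is binary and omitted when it is unary. $D_{\ell1}$ denotes $D_i$ with $i=\ell1$, and likewise for $w_{\ell1}$, $e_{\ell1}$. $e_i$ is the $i$-th row of the identity matrix of appropriate dimension. For $\mathcal Z\subset\mathbb{R}^p$, $R\in\mathbb{R}^{q\times p}$, $\mathcal Y\subset\mathbb{R}^q$: $R\mathcal Z=\{Rz\mid z\in\mathcal Z\}$, and the generalized intersection is $\mathcal Z\cap_R\mathcal Y=\{z\in\mathcal Z\mid Rz\in\mathcal Y\}$. $\times$ is the Cartesian product. *)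

theory Defs
  imports "Jordan_Normal_Form.Matrix"
begin

text \<open>
  The dimensions vary inside the statement, so \<open>\<real>\<^sup>p\<close> is \<open>carrier_vec p\<close>.
  Coordinates are numbered from 1 as in the mathematics, whereas the library's vectors are indexed
  from 0: \<open>entry w j\<close> is the coordinate \<open>w\<^sub>j\<close>, and \<open>e p j\<close> is the \<open>j\<close>-th row of the
  \<open>p \<times> p\<close> identity matrix.
\<close>

definition entry :: "real vec \<Rightarrow> nat \<Rightarrow> real" where
  "entry w j = w $ (j - 1)"

definition e :: "nat \<Rightarrow> nat \<Rightarrow> real vec" where
  "e p j = unit_vec p (j - 1)"

definition gen_inter :: "real vec set \<Rightarrow> real mat \<Rightarrow> real vec set \<Rightarrow> real vec set" where
  "gen_inter Z R Y = {z \<in> Z. R *\<^sub>v z \<in> Y}"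

text \<open>The product of a subset of \<open>\<real>\<^sup>p\<close> with a subset of \<open>\<real>\<close>, as a subset of \<open>\<real>\<^sup>p\<^sup>+\<^sup>1\<close>.\<close>

definition vec_times :: "real vec set \<Rightarrow> real set \<Rightarrow> real vec set" where
  "vec_times Z D = {z @\<^sub>v vec_of_list [d] | z d. z \<in> Z \<and> d \<in> D}"

text \<open>
  \<open>Unary g i\<close> stands for \<open>w\<^sub>j = g (w\<^sub>i)\<close>, and \<open>Binary g i k\<close> for \<open>w\<^sub>j = g (w\<^sub>i, w\<^sub>k)\<close>:
  the function \<open>h\<^sub>j\<close> together with its fixed argument indices. The two indices of a binary
  function may coincide.
\<close>

datatype elem_fun =
    Unary "real \<Rightarrow> real" nat
  | Binary "real \<Rightarrow> real \<Rightarrow> real" nat nat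

fun args :: "elem_fun \<Rightarrow> nat list" where
  "args (Unary g i) = [i]"
| "args (Binary g i k) = [i, k]"

fun eval :: "elem_fun \<Rightarrow> real vec \<Rightarrow> real" where
  "eval (Unary g i) w = g (entry w i)"
| "eval (Binary g i k) w = g (entry w i) (entry w k)"

definition functional_decomposition ::
    "nat \<Rightarrow> nat \<Rightarrow> nat \<Rightarrow> (nat \<Rightarrow> elem_fun) \<Rightarrow> (real vec \<Rightarrow> real vec) \<Rightarrow> bool" where
  "functional_decomposition n m K f h \<longleftrightarrow>
     m \<le> n + K \<and>
     (\<forall>j\<in>{n+1..n+K}. set (args (f j)) \<subseteq> {1..j-1}) \<and>
     (\<forall>x\<in>carrier_vec n. \<exists>w\<in>carrier_vec (n + K).
        (\<forall>j\<in>{1..n}. entry w j = entry x j) \<and>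
        (\<forall>j\<in>{n+1..n+K}. entry w j = eval (f j) w) \<and>
        h x = vec_last w m)"

definition H_set :: "nat \<Rightarrow> nat \<Rightarrow> (nat \<Rightarrow> elem_fun) \<Rightarrow> real vec set \<Rightarrow> real vec set" where
  "H_set n K f DH =
     {w \<in> carrier_vec (n + K). vec_first w n \<in> DH \<and> (\<forall>j\<in>{n+1..n+K}. entry w j = eval (f j) w)}"

text \<open>The set \<open>\<H>\<^sub>l\<close>, the graph of \<open>h\<^sub>l\<close> over the boxes given by \<open>D\<close>.\<close>

fun H_graph :: "(nat \<Rightarrow> real set) \<Rightarrow> elem_fun \<Rightarrow> real vec set" where
  "H_graph D (Unary g i) = {vec_of_list [u, g u] | u. u \<in> D i}"
| "H_graph D (Binary g i k) = {vec_of_list [u, v, g u v] | u v. u \<in> D i \<and> v \<in> D k}"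

definition E_mat :: "(nat \<Rightarrow> elem_fun) \<Rightarrow> nat \<Rightarrow> real mat" where
  "E_mat f l = mat_of_rows l (map (e l) (args (f l) @ [l]))"

text \<open>\<open>H_partial n f DH D k\<close> is \<open>\<H>\<^sub>1\<^sub>:\<^sub>l\<close> for \<open>l = n + k\<close>, a subset of \<open>\<real>\<^sup>l\<close>.\<close>

primrec H_partial ::
    "nat \<Rightarrow> (nat \<Rightarrow> elem_fun) \<Rightarrow> real vec set \<Rightarrow> (nat \<Rightarrow> real set) \<Rightarrow> nat \<Rightarrow> real vec set" where
  "H_partial n f DH D 0 = DH"
| "H_partial n f DH D (Suc k) =
     (let l = n + Suc k in
      gen_inter (vec_times (H_partial n f DH D k) (D l)) (E_mat f l) (H_graph D (f l)))"

end

theory Submission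
  imports Defs
begin

text \<open>
  By induction on \<open>k\<close>, \<open>\<H>\<^sub>1\<^sub>:\<^sub>n\<^sub>+\<^sub>k\<close> is the analogue of \<open>\<H>\<close> for the first \<open>k\<close> compositions.
  The sets \<open>D\<^sub>j\<close> never cut anything off, because every point of such a truncated set is the initial
  segment of a point of \<open>\<H>\<close>: the remaining coordinates are computed one after the other.
\<close>

lemma e_scalar_prod:
  assumes "w \<in> carrier_vec p" and "j \<in> {1..p}"
  shows "e p j \<bullet> w = entry w j"
  using assms by (auto simp: e_def entry_def)

lemma append1_carrier_vec:
  assumes "z \<in> carrier_vec p"
  shows "z @\<^sub>v vec_of_list [d] \<in> carrier_vec (Suc p)"
  using assms by (intro carrier_vecI) simp

lemma entry_append1:
  assumes "z \<in> carrier_vec p" and "j \<in> {1..p}"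
  shows "entry (z @\<^sub>v vec_of_list [d]) j = entry z j"
  using assms by (auto simp: entry_def)

lemma entry_append1_last:
  assumes "z \<in> carrier_vec p"
  shows "entry (z @\<^sub>v vec_of_list [d]) (Suc p) = d"
  using assms by (auto simp: entry_def)

lemma vec_first_append1:
  assumes "z \<in> carrier_vec p" and "n \<le> p"
  shows "vec_first (z @\<^sub>v vec_of_list [d]) n = vec_first z n"
  using assms by (auto simp: vec_first_def)

lemma vec_split_last:
  assumes "w \<in> carrier_vec (Suc p)"
  shows "w = vec_first w p @\<^sub>v vec_of_list [entry w (Suc p)]"
proof (rule eq_vecI)
  fix i assume "i < dim_vec (vec_first w p @\<^sub>v vec_of_list [entry w (Suc p)])"
  then show "w $ i = (vec_first w p @\<^sub>v vec_of_list [entry w (Suc p)]) $ i"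
    by (cases "i < p") (auto simp: vec_first_def entry_def less_Suc_eq)
qed (use assms in auto)

lemma eval_append1:
  assumes "z \<in> carrier_vec p" and "set (args g) \<subseteq> {1..p}"
  shows "eval g (z @\<^sub>v vec_of_list [d]) = eval g z"
  using assms by (cases g) (auto simp: entry_append1 simp del: vec_of_list_Cons)

text \<open>The rows of \<open>E_mat f l\<close> are unit vectors, so the product only selects
  coordinates. This makes the condition in the generalized intersection one about the arguments and
  the value of the composition.\<close>

lemma E_mat_mult_vec:
  assumes "w \<in> carrier_vec l" and "l \<ge> 1" and "set (args (f l)) \<subseteq> {1..l-1}"
  shows "E_mat f l *\<^sub>v w = vec_of_list (map (entry w) (args (f l) @ [l]))"
proof (rule eq_vecI)
  fix i assume "i < dim_vec (vec_of_list (map (entry w) (args (f l) @ [l])))"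
  then have i: "i < length (args (f l) @ [l])"
    by simp
  have "set (args (f l) @ [l]) \<subseteq> {1..l}"
    using subset_trans[OF assms(3), of "{1..l}"] assms(2) by simp
  then have "(args (f l) @ [l]) ! i \<in> {1..l}"
    using nth_mem[OF i] by (rule subsetD)
  moreover have "(E_mat f l *\<^sub>v w) $ i = e l ((args (f l) @ [l]) ! i) \<bullet> w"
  proof -
    have "i < dim_row (E_mat f l)"
      using i by (simp add: E_mat_def)
    moreover have "row (E_mat f l) i = map (e l) (args (f l) @ [l]) ! i"
      unfolding E_mat_def using i by (intro mat_of_rows_row) (simp_all only: nth_map length_map, simp add: e_def)
    ultimately show ?thesis
      using i by (simp only: index_mult_mat_vec nth_map)
  qed
  moreover have "vec_of_list (map (entry w) (args (f l) @ [l])) $ i = entry w ((args (f l) @ [l]) ! i)"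
    using i by (simp only: vec_of_list_index nth_map)
  ultimately show "(E_mat f l *\<^sub>v w) $ i = vec_of_list (map (entry w) (args (f l) @ [l])) $ i"
    using assms(1) by (simp only: e_scalar_prod)
qed (simp add: E_mat_def)

lemma vec_of_list_inject: "vec_of_list xs = vec_of_list ys \<longleftrightarrow> xs = ys"
  by (metis list_vec)

text \<open>Comparing lists entrywise forces the parameters of the graph to be the selected
  coordinates. What remains separates into box constraints, which will turn out to be automatic, and
  the defining equation. Coinciding argument indices cause no conflict.\<close>

lemma mem_H_graph_iff:
  "vec_of_list (map (entry w) (args g @ [l])) \<in> H_graph D g \<longleftrightarrow>
     (\<forall>i\<in>set (args g). entry w i \<in> D i) \<and> entry w l = eval g w"
  by (cases g) (auto simp: vec_of_list_inject simp del: vec_of_list_Cons)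

text \<open>The new equation determines the last coordinate from the earlier ones, and no earlier
  equation refers to that coordinate, so the longer set is a graph over the shorter one.\<close>

lemma H_set_Suc:
  assumes "set (args (f (n + Suc k))) \<subseteq> {1..n + k}"
    and "\<And>j. j \<in> {n+1..n+k} \<Longrightarrow> set (args (f j)) \<subseteq> {1..j-1}"
  shows "H_set n (Suc k) f DH =
    {z @\<^sub>v vec_of_list [eval (f (n + Suc k)) z] | z. z \<in> H_set n k f DH}"
proof -
  \<comment> \<open>Leaving \<open>d\<close> arbitrary lets this single equivalence serve both
    inclusions.\<close>
  have mem: "z @\<^sub>v vec_of_list [d] \<in> H_set n (Suc k) f DH \<longleftrightarrow>
      z \<in> H_set n k f DH \<and> d = eval (f (n + Suc k)) z"
    if z: "z \<in> carrier_vec (n + k)" for z d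
  proof -
    let ?w = "z @\<^sub>v vec_of_list [d]"
    have w: "?w \<in> carrier_vec (n + Suc k)"
      using append1_carrier_vec[OF z] by simp
    \<comment> \<open>Both \<open>j\<close> and the arguments of \<open>f j\<close> lie within the
      coordinates of \<open>z\<close>, so appending \<open>d\<close> changes neither side.\<close>
    have step: "entry ?w j = eval (f j) ?w \<longleftrightarrow> entry z j = eval (f j) z" if "j \<in> {n+1..n+k}" for j
    proof -
      have "{1..j-1} \<subseteq> {1..n+k}"
        using that by auto
      with assms(2)[OF that] have "set (args (f j)) \<subseteq> {1..n+k}"
        by (rule subset_trans)
      then show ?thesis
        using eval_append1[OF z] entry_append1[OF z, of j] that by simp
    qed
    have last: "entry ?w (n + Suc k) = eval (f (n + Suc k)) ?w \<longleftrightarrow> d = eval (f (n + Suc k)) z"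
      using eval_append1[OF z assms(1)] entry_append1_last[OF z] by simp
    have first: "vec_first ?w n = vec_first z n"
      using vec_first_append1[OF z] by simp
    have "{n+1..n+Suc k} = insert (n + Suc k) {n+1..n+k}"
      by auto
    then have "(\<forall>j\<in>{n+1..n+Suc k}. entry ?w j = eval (f j) ?w) \<longleftrightarrow>
        d = eval (f (n + Suc k)) z \<and> (\<forall>j\<in>{n+1..n+k}. entry z j = eval (f j) z)"
      using step last by (simp only: ball_simps cong: ball_cong)
    then show ?thesis
      using w first z by (auto simp only: H_set_def mem_Collect_eq)
  qed
  show ?thesis
  proof (intro equalityI subsetI)
    fix w assume w: "w \<in> H_set n (Suc k) f DH"
    let ?z = "vec_first w (n + k)" and ?d = "entry w (Suc (n + k))"
    have eq: "w = ?z @\<^sub>v vec_of_list [?d]"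
      using w by (intro vec_split_last) (simp add: H_set_def)
    have "?z @\<^sub>v vec_of_list [?d] \<in> H_set n (Suc k) f DH"
      using w by (simp only: eq[symmetric])
    then have z: "?z \<in> H_set n k f DH" and d: "?d = eval (f (n + Suc k)) ?z"
      by (simp_all only: mem[OF vec_first_carrier])
    show "w \<in> {z @\<^sub>v vec_of_list [eval (f (n + Suc k)) z] | z. z \<in> H_set n k f DH}"
      using eq[unfolded d] z by blast
  next
    fix w assume "w \<in> {z @\<^sub>v vec_of_list [eval (f (n + Suc k)) z] | z. z \<in> H_set n k f DH}"
    then obtain z where "w = z @\<^sub>v vec_of_list [eval (f (n + Suc k)) z]" "z \<in> H_set n k f DH"
      by blast
    moreover from this(2) have "z \<in> carrier_vec (n + k)"
      by (simp add: H_set_def)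
    ultimately show "w \<in> H_set n (Suc k) f DH"
      by (simp only: mem)
  qed
qed

text \<open>Needed because the sets \<open>D j\<close> are only known to bound points of the full
  set. Agreement is stated coordinatewise since the two vectors differ in dimension.\<close>

lemma H_set_extend:
  assumes "k \<le> K"
    and "\<And>j. j \<in> {n+1..n+K} \<Longrightarrow> set (args (f j)) \<subseteq> {1..j-1}"
    and "z \<in> H_set n k f DH"
  shows "\<exists>w\<in>H_set n K f DH. \<forall>j\<in>{1..n+k}. entry w j = entry z j"
  using assms
proof (induction K rule: dec_induct)
  case base
  then show ?case by blast
next
  case (step K)
  then obtain w where w: "w \<in> H_set n K f DH" "\<forall>j\<in>{1..n+k}. entry w j = entry z j"
    by fastforce
  \<comment> \<open>The appended value is the one that the next equation forces.\<close>
  let ?w = "w @\<^sub>v vec_of_list [eval (f (n + Suc K)) w]"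
  have "set (args (f (n + Suc K))) \<subseteq> {1..n + K}"
    using step.prems(1)[of "n + Suc K"] by simp
  then have "?w \<in> H_set n (Suc K) f DH"
    using H_set_Suc[of f n K DH] step.prems(1) w(1) by auto
  moreover have "entry ?w j = entry z j" if "j \<in> {1..n+k}" for j
    using entry_append1[of w "n + K" j] w that step.hyps by (auto simp: H_set_def simp del: vec_of_list_Cons)
  ultimately show ?case by blast
qed

lemma H_partial_eq_H_set:
  assumes "k \<le> K"
    and args: "\<And>j. j \<in> {n+1..n+K} \<Longrightarrow> set (args (f j)) \<subseteq> {1..j-1}"
    and DH: "DH \<subseteq> carrier_vec n"
    and D: "\<And>w j. w \<in> H_set n K f DH \<Longrightarrow> j \<in> {1..n+K} \<Longrightarrow> entry w j \<in> D j"
  shows "H_partial n f DH D k = H_set n k f DH"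
  using assms(1)
proof (induction k)
  case 0
  have "vec_first w n = w" if "w \<in> carrier_vec n" for w :: "real vec"
    using that by (auto simp: vec_first_def)
  then show ?case
    using DH by (auto simp: H_set_def)
next
  case (Suc k)
  let ?l = "n + Suc k"
  \<comment> \<open>The bounds pass from full points to truncated ones. The length \<open>i\<close>
    is free: it will be \<open>k\<close> for the arguments of the new composition and
    \<open>Suc k\<close> for its value.\<close>
  have D': "entry z j \<in> D j" if "z \<in> H_set n i f DH" "i \<le> K" "j \<in> {1..n+i}" for z i j
    using H_set_extend[OF that(2) args that(1)] D that(2,3)
    by (metis add_left_mono atLeastAtMost_iff le_trans)
  have args_l: "set (args (f ?l)) \<subseteq> {1..n+k}"
    using args[of ?l] Suc.prems by simp
  have Suc_eq: "H_set n (Suc k) f DH = {z @\<^sub>v vec_of_list [eval (f ?l) z] | z. z \<in> H_set n k f DH}"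
    using Suc.prems args by (intro H_set_Suc args_l) auto
  \<comment> \<open>Over points of the truncated set the box constraints hold by \<open>D'\<close>,
    so membership in the graph reduces to the equation.\<close>
  have E: "E_mat f ?l *\<^sub>v (z @\<^sub>v vec_of_list [d]) \<in> H_graph D (f ?l) \<longleftrightarrow> d = eval (f ?l) z"
    if z: "z \<in> H_set n k f DH" for z d
  proof -
    have zc: "z \<in> carrier_vec (n + k)"
      using z by (simp add: H_set_def)
    let ?w = "z @\<^sub>v vec_of_list [d]"
    have "E_mat f ?l *\<^sub>v ?w = vec_of_list (map (entry ?w) (args (f ?l) @ [?l]))"
      using append1_carrier_vec[OF zc, of d] args_l by (intro E_mat_mult_vec) simp_all
    moreover have "entry ?w i \<in> D i" if "i \<in> set (args (f ?l))" for i
      using entry_append1[OF zc, of i d] D'[OF z, of i] Suc.prems that args_l by auto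
    ultimately show ?thesis
      using mem_H_graph_iff eval_append1[OF zc args_l] entry_append1_last[OF zc, of d]
      by (metis add_Suc_right)
  qed
  \<comment> \<open>The factor \<open>D ?l\<close> of the product does not exclude the computed
    value, since that value is the last coordinate of a point one step longer.\<close>
  have Dl: "eval (f ?l) z \<in> D ?l" if z: "z \<in> H_set n k f DH" for z
  proof -
    have "z @\<^sub>v vec_of_list [eval (f ?l) z] \<in> H_set n (Suc k) f DH"
      using z Suc_eq by blast
    from D'[OF this Suc.prems, of ?l] show ?thesis
      using entry_append1_last[of z "n + k"] z by (simp add: H_set_def)
  qed
  have IH: "H_partial n f DH D k = H_set n k f DH"
    using Suc by simp
  show ?case
    unfolding H_partial.simps Let_def gen_inter_def vec_times_def IH Suc_eq
  proof (intro equalityI subsetI; elim CollectE exE conjE)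
    fix w z d
    assume w: "w = z @\<^sub>v vec_of_list [d]" and z: "z \<in> H_set n k f DH"
      and "E_mat f ?l *\<^sub>v w \<in> H_graph D (f ?l)"
    then have "d = eval (f ?l) z"
      using E[OF z] by (simp only:)
    then show "w \<in> {z @\<^sub>v vec_of_list [eval (f ?l) z] | z. z \<in> H_set n k f DH}"
      using w z by blast
  next
    fix w z
    assume w: "w = z @\<^sub>v vec_of_list [eval (f ?l) z]" and z: "z \<in> H_set n k f DH"
    then have "E_mat f ?l *\<^sub>v w \<in> H_graph D (f ?l)"
      using E[OF z] by (simp only:)
    then show "w \<in> {w \<in> {z @\<^sub>v vec_of_list [d] | z d. z \<in> H_set n k f DH \<and> d \<in> D ?l}.
        E_mat f ?l *\<^sub>v w \<in> H_graph D (f ?l)}"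
      using w z Dl[OF z] by blast
  qed
qed

theorem theorem4:
  fixes n m K :: nat
    and h :: "real vec \<Rightarrow> real vec"
    and f :: "nat \<Rightarrow> elem_fun"
    and DH :: "real vec set"
    and D :: "nat \<Rightarrow> real set"
  assumes "functional_decomposition n m K f h"
    and "DH \<subseteq> carrier_vec n"
    and "\<And>j. j \<in> {1..n+K} \<Longrightarrow> (\<lambda>w. e (n + K) j \<bullet> w) ` H_set n K f DH \<subseteq> D j"
  shows "H_partial n f DH D K = H_set n K f DH"
proof (rule H_partial_eq_H_set[OF order_refl _ assms(2)])
  show "set (args (f j)) \<subseteq> {1..j-1}" if "j \<in> {n+1..n+K}" for j
    using assms(1) that by (simp add: functional_decomposition_def)
  \<comment> \<open>Multiplying by a row of the identity reads off a coordinate, so the projection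
    hypothesis becomes a pointwise bound.\<close>
  show "entry w j \<in> D j" if "w \<in> H_set n K f DH" "j \<in> {1..n+K}" for w j
    using assms(3)[OF that(2)] e_scalar_prod[of w "n + K" j] that by (auto simp: H_set_def)
qed

end
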